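(* Let $R,g,\mu_t>0$, $\mu_c\ge\frac12$, $\omega_{x,0}>0$, $v_0\in\mathbb{R}$, $\varepsilon\in\{1,-1\}$. Put $q=\sqrt{4\mu_c^2-1}$, $K=2\sqrt{16\mu_c^2-3}+\mu_t$ and $$T=\frac{2\,\omega_{x,0}R\,K}{15\,\mu_tg}.$$ The following is a motion of the ball along the cushion (in the sense of the context). For $t\in[0,T)$, $$\dot x(t)=v_0+\varepsilon\,\frac{5\mu_tg\,t\,q}{K},\qquad \omega_x(t)=\omega_{x,0}-\frac{15\mu_tg\,t}{2RK},$$ $$\omega_y(t)=\frac{v_0}{R}+2\varepsilon\Bigl(\omega_{x,0}-\frac{5\mu_tg\,t}{RK}\Bigr)q,\qquad \omega_z(t)=-\frac{v_0}{R}-\varepsilon\Bigl(\omega_{x,0}-\frac{5\mu_tg\,t}{2RK}\Bigr)q,$$ and for $t\in[T,\infty)$, $$\dot x(t)=v_0+\tfrac23\varepsilon R\,\omega_{x,0}\,q,\quad \omega_x(t)=0,\quad \omega_y(t)=\frac{v_0}{R}+\tfrac23\varepsilon\,\omega_{x,0}\,q,\quad \omega_z(t)=-\frac{v_0}{R}-\tfrac23\varepsilon\,\omega_{x,0}\,q .$$ On $[0,T)$ it satisfies $\Omega_y=2\varepsilon q\,\Omega_x$ and $\Omega_z=-\varepsilon q\,\Omega_x$ (so the direction of $\Omega=(\Omega_x,\Omega_y,\Omega_z)$ does not change until the moment $T$), and from $t=T$ on the ball rolls without sliding at both points of contact.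
   Context: A rigid homogeneous ball of radius $R$ moves in contact with a horizontal table and a vertical cushion, with isotropic dry friction coefficients $\mu_t$ (table) and $\mu_c$ (cushion) and gravity $g$. $\dot x$ is the velocity of its center along the cushion and $(\omega_x,\omega_y,\omega_z)$ is its angular velocity. Define $\Omega_x=\omega_x$, $\Omega_y=\omega_y-\dot x/R$, $\Omega_z=\omega_z+\dot x/R$, and $$D=\mu_c\mu_t\Omega_x^2+\sqrt{\Omega_x^2+\Omega_y^2}\,\sqrt{\Omega_x^2+\Omega_z^2}.$$ A motion of the ball along the cushion is a continuous quadruple of functions $(\dot x,\omega_x,\omega_y,\omega_z)$ of time such that: (a) while $\Omega_x>0$, it satisfies the equations $$\ddot x=-\frac{g\mu_t\bigl(\mu_c\Omega_x\Omega_z-\Omega_y\sqrt{\Omega_x^2+\Omega_z^2}\bigr)}{D},\qquad \dot\Omega_x=-\frac{5g\mu_t\Omega_x\bigl(\mu_c\Omega_x+\sqrt{\Omega_x^2+\Omega_z^2}\bigr)}{2R\,D},$$ $$\dot\Omega_y=\frac{g\mu_t\bigl(2\mu_c\Omega_x\Omega_z-7\Omega_y\sqrt{\Omega_x^2+\Omega_z^2}\bigr)}{2R\,D},\qquad \dot\Omega_z=-\frac{g\mu_t\bigl(7\mu_c\Omega_x\Omega_z-2\Omega_y\sqrt{\Omega_x^2+\Omega_z^2}\bigr)}{2R\,D};$$ (b) once $\Omega_x=\Omega_y=\Omega_z=0$ (rolling along the cushion without sliding at both points of contact), it remains in this regime with $\dot x,\omega_x,\omega_y,\omega_z$ constant.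 *)

theory Defs
  imports "HOL-Analysis.Analysis"
begin

text \<open>
  The velocity of the centre along the cushion is \<open>v\<close>, and the angular velocity is
  \<open>(\<omega>\<^sub>x, \<omega>\<^sub>y, \<omega>\<^sub>z)\<close>. The vector \<open>\<Omega>\<close> vanishes exactly when neither contact point slides:
  the slip velocity is \<open>R(-\<Omega>\<^sub>y, \<Omega>\<^sub>x)\<close> at the table (directions along and normal to the cushion),
  and \<open>R(\<Omega>\<^sub>z, -\<Omega>\<^sub>x)\<close> at the cushion (directions along the cushion and vertical).
\<close>

definition Omega :: "real \<Rightarrow> real \<Rightarrow> real \<Rightarrow> real \<Rightarrow> real \<Rightarrow> real ^ 3" where
  "Omega R v \<omega>\<^sub>x \<omega>\<^sub>y \<omega>\<^sub>z = vector [\<omega>\<^sub>x, \<omega>\<^sub>y - v / R, \<omega>\<^sub>z + v / R]"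

definition rolls_without_sliding :: "real \<Rightarrow> real \<Rightarrow> real \<Rightarrow> real \<Rightarrow> real \<Rightarrow> bool" where
  "rolls_without_sliding R v \<omega>\<^sub>x \<omega>\<^sub>y \<omega>\<^sub>z \<longleftrightarrow> Omega R v \<omega>\<^sub>x \<omega>\<^sub>y \<omega>\<^sub>z = 0"

definition slip_denominator :: "real \<Rightarrow> real \<Rightarrow> real \<Rightarrow> real \<Rightarrow> real \<Rightarrow> real" where
  "slip_denominator \<mu>\<^sub>t \<mu>\<^sub>c X Y Z =
     \<mu>\<^sub>c * \<mu>\<^sub>t * X\<^sup>2 + sqrt (X\<^sup>2 + Y\<^sup>2) * sqrt (X\<^sup>2 + Z\<^sup>2)"

text \<open>Equations of motion at time \<open>t\<close>; time runs over \<open>[0, \<infinity>)\<close>, so derivatives at \<open>0\<close> are one-sided.\<close>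

definition sliding_equations ::
  "real \<Rightarrow> real \<Rightarrow> real \<Rightarrow> real \<Rightarrow> (real \<Rightarrow> real) \<Rightarrow> (real \<Rightarrow> real ^ 3) \<Rightarrow> real \<Rightarrow> bool" where
  "sliding_equations R g \<mu>\<^sub>t \<mu>\<^sub>c v \<Omega> t \<longleftrightarrow>
    (let X = \<Omega> t $ 1; Y = \<Omega> t $ 2; Z = \<Omega> t $ 3;
         S = sqrt (X\<^sup>2 + Z\<^sup>2); D = slip_denominator \<mu>\<^sub>t \<mu>\<^sub>c X Y Z
     in
       (v has_real_derivative
          - (g * \<mu>\<^sub>t * (\<mu>\<^sub>c * X * Z - Y * S) / D)) (at t within {0..}) \<and>
       ((\<lambda>s. \<Omega> s $ 1) has_real_derivative
          - (5 * g * \<mu>\<^sub>t * X * (\<mu>\<^sub>c * X + S) / (2 * R * D))) (at t within {0..}) \<and>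
       ((\<lambda>s. \<Omega> s $ 2) has_real_derivative
          g * \<mu>\<^sub>t * (2 * \<mu>\<^sub>c * X * Z - 7 * Y * S) / (2 * R * D)) (at t within {0..}) \<and>
       ((\<lambda>s. \<Omega> s $ 3) has_real_derivative
          - (g * \<mu>\<^sub>t * (7 * \<mu>\<^sub>c * X * Z - 2 * Y * S) / (2 * R * D))) (at t within {0..}))"

definition motion_along_cushion ::
  "real \<Rightarrow> real \<Rightarrow> real \<Rightarrow> real \<Rightarrow>
   (real \<Rightarrow> real) \<Rightarrow> (real \<Rightarrow> real) \<Rightarrow> (real \<Rightarrow> real) \<Rightarrow> (real \<Rightarrow> real) \<Rightarrow> bool" where
  "motion_along_cushion R g \<mu>\<^sub>t \<mu>\<^sub>c v \<omega>\<^sub>x \<omega>\<^sub>y \<omega>\<^sub>z \<longleftrightarrow>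
    continuous_on {0..} v \<and> continuous_on {0..} \<omega>\<^sub>x \<and>
    continuous_on {0..} \<omega>\<^sub>y \<and> continuous_on {0..} \<omega>\<^sub>z \<and>
    (let \<Omega> = (\<lambda>t. Omega R (v t) (\<omega>\<^sub>x t) (\<omega>\<^sub>y t) (\<omega>\<^sub>z t))
     in \<forall>t\<ge>0. \<Omega> t $ 1 > 0 \<longrightarrow> sliding_equations R g \<mu>\<^sub>t \<mu>\<^sub>c v \<Omega> t) \<and>
    (\<forall>s\<ge>0. rolls_without_sliding R (v s) (\<omega>\<^sub>x s) (\<omega>\<^sub>y s) (\<omega>\<^sub>z s) \<longrightarrow>
      (\<forall>t\<ge>s. rolls_without_sliding R (v t) (\<omega>\<^sub>x t) (\<omega>\<^sub>y t) (\<omega>\<^sub>z t) \<and>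
        v t = v s \<and> \<omega>\<^sub>x t = \<omega>\<^sub>x s \<and> \<omega>\<^sub>y t = \<omega>\<^sub>y s \<and> \<omega>\<^sub>z t = \<omega>\<^sub>z s))"

end

theory Submission
  imports Defs
begin

text \<open>
  Along the ray \<open>(Y, Z) = (2\<epsilon>q X, -\<epsilon>q X)\<close>, \<open>X > 0\<close>, one has
  \<open>X\<^sup>2 + Z\<^sup>2 = (2\<mu>\<^sub>c X)\<^sup>2\<close> and \<open>X\<^sup>2 + Y\<^sup>2 = (16\<mu>\<^sub>c\<^sup>2 - 3) X\<^sup>2\<close>, so the denominator is
  \<open>\<mu>\<^sub>c K X\<^sup>2\<close>. All right-hand sides are therefore constant on the ray, and the vector field of
  \<open>\<Omega>\<close> is tangent to it: \<open>\<Omega>\<close> shrinks linearly to \<open>0\<close> at the rate \<open>15\<mu>\<^sub>t g / (2RK)\<close>.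
\<close>

lemma slip_on_invariant_ray:
  fixes X Y Z \<mu>\<^sub>t \<mu>\<^sub>c \<epsilon> q :: real
  assumes X: "X > 0" and \<mu>\<^sub>c: "\<mu>\<^sub>c \<ge> 1 / 2" and \<epsilon>: "\<epsilon>\<^sup>2 = 1"
    and q: "q = sqrt (4 * \<mu>\<^sub>c\<^sup>2 - 1)"
    and Y: "Y = 2 * \<epsilon> * q * X" and Z: "Z = - \<epsilon> * q * X"
  shows "sqrt (X\<^sup>2 + Z\<^sup>2) = 2 * \<mu>\<^sub>c * X"
    and "slip_denominator \<mu>\<^sub>t \<mu>\<^sub>c X Y Z = \<mu>\<^sub>c * (2 * sqrt (16 * \<mu>\<^sub>c\<^sup>2 - 3) + \<mu>\<^sub>t) * X\<^sup>2"
proof -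
  \<comment> \<open>Makes the radicand of \<open>q\<close> nonnegative: squaring
    \<open>sqrt a\<close> returns \<open>a\<close> only for \<open>a \<ge> 0\<close>, since the
    total \<open>sqrt\<close> is odd.\<close>
  have "(1 / 2)\<^sup>2 \<le> \<mu>\<^sub>c\<^sup>2"
    using \<mu>\<^sub>c by (intro power_mono) auto
  then have q2: "q\<^sup>2 = 4 * \<mu>\<^sub>c\<^sup>2 - 1"
    unfolding q by (subst real_sqrt_pow2) (auto simp: power2_eq_square)
  have "X\<^sup>2 + Z\<^sup>2 = X\<^sup>2 * (1 + \<epsilon>\<^sup>2 * q\<^sup>2)"
    unfolding Z by (simp add: algebra_simps power_mult_distrib)
  also have "\<dots> = (2 * \<mu>\<^sub>c * X)\<^sup>2"
    unfolding \<epsilon> q2 by (simp add: algebra_simps power_mult_distrib)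
  finally show S: "sqrt (X\<^sup>2 + Z\<^sup>2) = 2 * \<mu>\<^sub>c * X"
    using X \<mu>\<^sub>c by simp
  have "X\<^sup>2 + Y\<^sup>2 = X\<^sup>2 * (1 + 4 * \<epsilon>\<^sup>2 * q\<^sup>2)"
    unfolding Y by (simp add: algebra_simps power_mult_distrib)
  also have "\<dots> = (16 * \<mu>\<^sub>c\<^sup>2 - 3) * X\<^sup>2"
    unfolding \<epsilon> q2 by (simp add: algebra_simps)
  finally have "sqrt (X\<^sup>2 + Y\<^sup>2) = sqrt (16 * \<mu>\<^sub>c\<^sup>2 - 3) * X"
    using X by (simp add: real_sqrt_mult)
  then show "slip_denominator \<mu>\<^sub>t \<mu>\<^sub>c X Y Z = \<mu>\<^sub>c * (2 * sqrt (16 * \<mu>\<^sub>c\<^sup>2 - 3) + \<mu>\<^sub>t) * X\<^sup>2"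
    unfolding slip_denominator_def S by (simp add: algebra_simps power2_eq_square)
qed

text \<open>Reduces the four equations to two facts about the motion: \<open>\<Omega>\<close> stays
  on the ray and its first component decreases at rate \<open>k\<close>, while \<open>v\<close>
  grows at the matching constant rate. The ray relations are assumed at every time \<open>s\<close>,
  so that they can be differentiated.\<close>

lemma sliding_equations_on_invariant_ray:
  fixes R g \<mu>\<^sub>t \<mu>\<^sub>c \<epsilon> q k t :: real and v :: "real \<Rightarrow> real" and \<Omega> :: "real \<Rightarrow> real ^ 3"
  assumes "R > 0" and "\<mu>\<^sub>t > 0" and \<mu>\<^sub>c: "\<mu>\<^sub>c \<ge> 1 / 2" and \<epsilon>: "\<epsilon>\<^sup>2 = 1"
    and q: "q = sqrt (4 * \<mu>\<^sub>c\<^sup>2 - 1)"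
    and k: "k = 15 * \<mu>\<^sub>t * g / (2 * R * (2 * sqrt (16 * \<mu>\<^sub>c\<^sup>2 - 3) + \<mu>\<^sub>t))"
    and X: "\<Omega> t $ 1 > 0"
    and Y: "\<And>s. \<Omega> s $ 2 = 2 * \<epsilon> * q * \<Omega> s $ 1"
    and Z: "\<And>s. \<Omega> s $ 3 = - \<epsilon> * q * \<Omega> s $ 1"
    and dX: "((\<lambda>s. \<Omega> s $ 1) has_real_derivative - k) (at t within {0..})"
    and dv: "(v has_real_derivative 2 / 3 * \<epsilon> * R * q * k) (at t within {0..})"
  shows "sliding_equations R g \<mu>\<^sub>t \<mu>\<^sub>c v \<Omega> t"
proof -
  define x where "x = \<Omega> t $ 1"
  define K where "K = 2 * sqrt (16 * \<mu>\<^sub>c\<^sup>2 - 3) + \<mu>\<^sub>t"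
  have x: "x > 0" and y: "\<Omega> t $ 2 = 2 * \<epsilon> * q * x" and z: "\<Omega> t $ 3 = - \<epsilon> * q * x"
    using X Y Z by (simp_all add: x_def)
  have "(1 / 2)\<^sup>2 \<le> \<mu>\<^sub>c\<^sup>2"
    using \<mu>\<^sub>c by (intro power_mono) auto
  then have "16 * \<mu>\<^sub>c\<^sup>2 - 3 \<ge> 0"
    by (simp add: power2_eq_square)
  then have K: "K > 0"
    using \<open>\<mu>\<^sub>t > 0\<close> unfolding K_def by (intro add_nonneg_pos) auto
  note ray = slip_on_invariant_ray[OF x \<mu>\<^sub>c \<epsilon> q y z, unfolded y z]
  note slip = ray(1) ray(2)[of \<mu>\<^sub>t, folded K_def]
  have nz: "x \<noteq> 0" "\<mu>\<^sub>c \<noteq> 0" "K \<noteq> 0" "R \<noteq> 0"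
    using x \<mu>\<^sub>c K \<open>R > 0\<close> by auto
  have dY: "((\<lambda>s. \<Omega> s $ 2) has_real_derivative 2 * \<epsilon> * q * (- k)) (at t within {0..})"
    unfolding Y by (intro DERIV_cmult dX)
  have dZ: "((\<lambda>s. \<Omega> s $ 3) has_real_derivative - \<epsilon> * q * (- k)) (at t within {0..})"
    unfolding Z by (intro DERIV_cmult dX)
  \<comment> \<open>Each right-hand side is homogeneous of degree 0, so
    \<open>\<mu>\<^sub>c * x\<^sup>2\<close> cancels. The numerators collect as 1 + 4 = 5 for
    \<open>v\<close>, then 5 * 3 = 15, 2 + 28 = 30 and 7 + 8 = 15 for the components of
    \<open>\<Omega>\<close>; the ratio 15 : 30 : 15 is the tangency to the ray.\<close>
  have ev: "- (g * \<mu>\<^sub>t * (\<mu>\<^sub>c * x * (- \<epsilon> * q * x) - 2 * \<epsilon> * q * x * (2 * \<mu>\<^sub>c * x)) / (\<mu>\<^sub>c * K * x\<^sup>2))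
      = 2 / 3 * \<epsilon> * R * q * k"
    using nz unfolding k K_def[symmetric] by (simp add: field_simps power2_eq_square)
  have eX: "- (5 * g * \<mu>\<^sub>t * x * (\<mu>\<^sub>c * x + 2 * \<mu>\<^sub>c * x) / (2 * R * (\<mu>\<^sub>c * K * x\<^sup>2))) = - k"
    using nz unfolding k K_def[symmetric] by (simp add: field_simps power2_eq_square)
  have eY: "g * \<mu>\<^sub>t * (2 * \<mu>\<^sub>c * x * (- \<epsilon> * q * x) - 7 * (2 * \<epsilon> * q * x) * (2 * \<mu>\<^sub>c * x))
      / (2 * R * (\<mu>\<^sub>c * K * x\<^sup>2)) = 2 * \<epsilon> * q * (- k)"
    using nz unfolding k K_def[symmetric] by (simp add: field_simps power2_eq_square)
  have eZ: "- (g * \<mu>\<^sub>t * (7 * \<mu>\<^sub>c * x * (- \<epsilon> * q * x) - 2 * (2 * \<epsilon> * q * x) * (2 * \<mu>\<^sub>c * x))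
      / (2 * R * (\<mu>\<^sub>c * K * x\<^sup>2))) = - \<epsilon> * q * (- k)"
    using nz unfolding k K_def[symmetric] by (simp add: field_simps power2_eq_square)
  show ?thesis
    unfolding sliding_equations_def Let_def x_def[symmetric] y z slip ev eX eY eZ
    by (intro conjI dv dX dY dZ)
qed

theorem mainTheorem6:
  fixes R g \<mu>\<^sub>t \<mu>\<^sub>c \<omega>\<^sub>0 v\<^sub>0 \<epsilon> q K T :: real
    and v \<omega>\<^sub>x \<omega>\<^sub>y \<omega>\<^sub>z :: "real \<Rightarrow> real"
    and \<Omega> :: "real \<Rightarrow> real ^ 3"
  assumes "R > 0" and "g > 0" and "\<mu>\<^sub>t > 0" and "\<mu>\<^sub>c \<ge> 1 / 2" and "\<omega>\<^sub>0 > 0"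
    and "\<epsilon> \<in> {1, -1}"
    and "q = sqrt (4 * \<mu>\<^sub>c\<^sup>2 - 1)"
    and "K = 2 * sqrt (16 * \<mu>\<^sub>c\<^sup>2 - 3) + \<mu>\<^sub>t"
    and "T = 2 * \<omega>\<^sub>0 * R * K / (15 * \<mu>\<^sub>t * g)"
    and "v = (\<lambda>t. if t < T then v\<^sub>0 + \<epsilon> * (5 * \<mu>\<^sub>t * g * t * q / K)
                  else v\<^sub>0 + 2 / 3 * \<epsilon> * R * \<omega>\<^sub>0 * q)"
    and "\<omega>\<^sub>x = (\<lambda>t. if t < T then \<omega>\<^sub>0 - 15 * \<mu>\<^sub>t * g * t / (2 * R * K) else 0)"
    and "\<omega>\<^sub>y = (\<lambda>t. if t < T then v\<^sub>0 / R + 2 * \<epsilon> * (\<omega>\<^sub>0 - 5 * \<mu>\<^sub>t * g * t / (R * K)) * q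
                   else v\<^sub>0 / R + 2 / 3 * \<epsilon> * \<omega>\<^sub>0 * q)"
    and "\<omega>\<^sub>z = (\<lambda>t. if t < T then - v\<^sub>0 / R - \<epsilon> * (\<omega>\<^sub>0 - 5 * \<mu>\<^sub>t * g * t / (2 * R * K)) * q
                   else - v\<^sub>0 / R - 2 / 3 * \<epsilon> * \<omega>\<^sub>0 * q)"
    and "\<Omega> = (\<lambda>t. Omega R (v t) (\<omega>\<^sub>x t) (\<omega>\<^sub>y t) (\<omega>\<^sub>z t))"
  shows "motion_along_cushion R g \<mu>\<^sub>t \<mu>\<^sub>c v \<omega>\<^sub>x \<omega>\<^sub>y \<omega>\<^sub>z \<and>
    (\<forall>t\<in>{0..<T}. \<Omega> t $ 2 = 2 * \<epsilon> * q * \<Omega> t $ 1 \<and> \<Omega> t $ 3 = - \<epsilon> * q * \<Omega> t $ 1) \<and>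
    (\<forall>t\<in>{0..<T}. \<Omega> t \<noteq> 0 \<and> sgn (\<Omega> t) = sgn (\<Omega> 0)) \<and>
    (\<forall>t\<ge>T. rolls_without_sliding R (v t) (\<omega>\<^sub>x t) (\<omega>\<^sub>y t) (\<omega>\<^sub>z t))"
proof -
  define k where "k = 15 * \<mu>\<^sub>t * g / (2 * R * K)"
  \<comment> \<open>Stopping the clock at \<open>T\<close> merges the sliding and rolling branches
    into one formula, so continuity across \<open>T\<close> follows from that of
    \<open>min\<close>.\<close>
  define X where "X = (\<lambda>t. \<omega>\<^sub>0 - k * min t T)"
  have \<epsilon>: "\<epsilon>\<^sup>2 = 1"
    using assms(6) by auto
  have "(1 / 2)\<^sup>2 \<le> \<mu>\<^sub>c\<^sup>2"
    using assms(4) by (intro power_mono) auto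
  then have "16 * \<mu>\<^sub>c\<^sup>2 - 3 \<ge> 0"
    by (simp add: power2_eq_square)
  then have K: "K > 0"
    unfolding assms(8) using assms(3) by (intro add_nonneg_pos) auto
  have k: "k > 0"
    using assms(1-3) K by (simp add: k_def)
  have T: "T > 0"
    unfolding assms(9) using assms(1-3,5) K by simp
  \<comment> \<open>\<open>T\<close> is the time at which the linear decay exhausts
    \<open>\<omega>\<^sub>0\<close>; this identity makes the two branches of each function agree at
    \<open>T\<close>.\<close>
  have kT: "k * T = \<omega>\<^sub>0"
    unfolding k_def assms(9) using assms(1-3) K by (simp add: field_simps)
  have m: "min t T = (if t < T then t else T)" for t
    by simp
  have v: "v = (\<lambda>t. v\<^sub>0 + 2 / 3 * \<epsilon> * R * q * (k * min t T))"
    unfolding assms(10) using assms(1) K by (auto simp: fun_eq_iff m kT) (simp_all add: k_def field_simps)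
  have \<omega>\<^sub>x: "\<omega>\<^sub>x = X"
    unfolding assms(11) X_def by (auto simp: fun_eq_iff m kT) (simp add: k_def)
  \<comment> \<open>The factors come from adding \<open>v / R\<close> to the second component of
    \<open>\<Omega>\<close> and subtracting it from the third: 2 - 2/3 = 2 * (2/3) here, and 1 - 2/3
    = 1/3 for \<open>\<omega>\<^sub>z\<close>.\<close>
  have \<omega>\<^sub>y: "\<omega>\<^sub>y = (\<lambda>t. v\<^sub>0 / R + 2 * \<epsilon> * (\<omega>\<^sub>0 - 2 / 3 * (k * min t T)) * q)"
    unfolding assms(12) using assms(1) K by (auto simp: fun_eq_iff m kT) (simp_all add: k_def field_simps)
  have \<omega>\<^sub>z: "\<omega>\<^sub>z = (\<lambda>t. - v\<^sub>0 / R - \<epsilon> * (\<omega>\<^sub>0 - 1 / 3 * (k * min t T)) * q)"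
    unfolding assms(13) using assms(1) K by (auto simp: fun_eq_iff m kT) (simp_all add: k_def field_simps)
  have \<Omega>1: "\<Omega> t $ 1 = X t" for t
    unfolding assms(14) Omega_def \<omega>\<^sub>x by simp
  \<comment> \<open>Holds at all times, also beyond \<open>T\<close>, where both sides
    vanish.\<close>
  have \<Omega>2: "\<Omega> t $ 2 = 2 * \<epsilon> * q * \<Omega> t $ 1" for t
    unfolding \<Omega>1 unfolding assms(14) Omega_def v \<omega>\<^sub>y X_def using assms(1) by (simp add: field_simps)
  have \<Omega>3: "\<Omega> t $ 3 = - \<epsilon> * q * \<Omega> t $ 1" for t
    unfolding \<Omega>1 unfolding assms(14) Omega_def v \<omega>\<^sub>z X_def using assms(1) by (simp add: field_simps)
  have \<Omega>: "\<Omega> t = X t *\<^sub>R vector [1, 2 * \<epsilon> * q, - \<epsilon> * q]" for t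
    by (simp add: vec_eq_iff forall_3 \<Omega>1 \<Omega>2 \<Omega>3)
  have Xpos: "X t > 0" if "t < T" for t
  proof -
    have "k * t < k * T"
      using that k by simp
    then show ?thesis
      using that by (simp add: X_def kT)
  qed
  have X0: "X t = 0" if "t \<ge> T" for t
    using that by (simp add: X_def kT min_absorb2)
  \<comment> \<open>With an equivalence, clause (b) of a motion becomes a statement about times
    after \<open>T\<close>, where \<open>min t T\<close> is constant.\<close>
  have rolls: "rolls_without_sliding R (v t) (\<omega>\<^sub>x t) (\<omega>\<^sub>y t) (\<omega>\<^sub>z t) \<longleftrightarrow> t \<ge> T" for t
  proof -
    have "rolls_without_sliding R (v t) (\<omega>\<^sub>x t) (\<omega>\<^sub>y t) (\<omega>\<^sub>z t) \<longleftrightarrow> \<Omega> t = 0"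
      by (simp add: rolls_without_sliding_def assms(14))
    also have "\<dots> \<longleftrightarrow> X t = 0"
      by (auto simp: vec_eq_iff forall_3 \<Omega>1 \<Omega>2 \<Omega>3)
    also have "\<dots> \<longleftrightarrow> t \<ge> T"
      using Xpos[of t] X0[of t] by force
    finally show ?thesis .
  qed
  have sliding: "sliding_equations R g \<mu>\<^sub>t \<mu>\<^sub>c v \<Omega> t" if "t \<ge> 0" "\<Omega> t $ 1 > 0" for t
  proof -
    \<comment> \<open>The equations are required only where the first component is positive, so the
      kink of \<open>min\<close> at \<open>T\<close> is avoided: within distance
      \<open>T - t\<close> of \<open>t\<close>, \<open>min s T\<close> is just
      \<open>s\<close>.\<close>
    have t: "t < T"
      using that X0[of t] by (force simp: \<Omega>1)
    have min: "((\<lambda>s. min s T) has_real_derivative 1) (at t within {0..})"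
      by (rule has_field_derivative_transform_within[OF DERIV_ident, of "T - t"])
         (use t that in \<open>auto simp: dist_real_def\<close>)
    have dX: "((\<lambda>s. \<Omega> s $ 1) has_real_derivative - k) (at t within {0..})"
      unfolding \<Omega>1 X_def by (rule derivative_eq_intros min refl | simp)+
    have dv: "(v has_real_derivative 2 / 3 * \<epsilon> * R * q * k) (at t within {0..})"
      unfolding v by (rule derivative_eq_intros min refl | simp)+
    show ?thesis
      by (rule sliding_equations_on_invariant_ray[OF assms(1,3,4) \<epsilon> assms(7)
            k_def[unfolded assms(8)] that(2) \<Omega>2 \<Omega>3 dX dv])
  qed
  have "motion_along_cushion R g \<mu>\<^sub>t \<mu>\<^sub>c v \<omega>\<^sub>x \<omega>\<^sub>y \<omega>\<^sub>z"
    unfolding motion_along_cushion_def Let_def assms(14)[symmetric] rolls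
  proof (intro conjI)
    show "continuous_on {0..} v" "continuous_on {0..} \<omega>\<^sub>x"
      "continuous_on {0..} \<omega>\<^sub>y" "continuous_on {0..} \<omega>\<^sub>z"
      unfolding v \<omega>\<^sub>x \<omega>\<^sub>y \<omega>\<^sub>z X_def by (intro continuous_intros)+
    show "\<forall>t\<ge>0. \<Omega> t $ 1 > 0 \<longrightarrow> sliding_equations R g \<mu>\<^sub>t \<mu>\<^sub>c v \<Omega> t"
      using sliding by blast
    show "\<forall>s\<ge>0. T \<le> s \<longrightarrow> (\<forall>t\<ge>s. T \<le> t \<and>
        v t = v s \<and> \<omega>\<^sub>x t = \<omega>\<^sub>x s \<and> \<omega>\<^sub>y t = \<omega>\<^sub>y s \<and> \<omega>\<^sub>z t = \<omega>\<^sub>z s)"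
      by (auto simp: v \<omega>\<^sub>x \<omega>\<^sub>y \<omega>\<^sub>z X_def min_absorb2)
  qed
  moreover have "\<Omega> t \<noteq> 0" if "t < T" for t
    using Xpos[OF that] \<Omega>1[of t] by auto
  \<comment> \<open>Both vectors are positive multiples of the same fixed vector, and
    \<open>sgn\<close> ignores positive scaling.\<close>
  moreover have "sgn (\<Omega> t) = sgn (\<Omega> 0)" if "t < T" for t
    using Xpos[OF that] Xpos[OF T] by (simp add: \<Omega> sgn_scaleR)
  ultimately show ?thesis
    using \<Omega>2 \<Omega>3 rolls by (metis atLeastLessThan_iff)
qed

end
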